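(* Let $\Gamma\curvearrowright(\Omega,\mu)$ be an action with invariant measure as described in the context, and let $X\subseteq\Omega$ be a measurable set of finite positive measure. Then the following are equivalent. (A) The set $X$ is a domain of expansion with respect to the action $\Gamma\curvearrowright\Omega$. (B) The action $\Gamma\curvearrowright\Omega$ has local spectral gap with respect to $X$.
   Context: Setting: $\Gamma$ is a group (not assumed countable), $(\Omega,\tau)$ is a Polish topological space with Borel $\sigma$-algebra $\mathcal{B}$, and $\Gamma\curvearrowright\Omega$ is a left action by Borel automorphisms. $\mu$ is a $\sigma$-finite measure on $(\Omega,\mathcal{B})$ which is non-zero on all non-empty open sets, and the action preserves $\mu$. Measurable means in the completion of $\mathcal{B}$ with respect to $\mu$. A measurable set $C\subseteq\Omega$ is a domain of expansion if $0<\mu(C)<\infty$ and for every real $\eta>0$ there is a finite set $R\subseteq\Gamma$ such that for all measurable $Y\subseteq C$ we have $\mu((R.Y)\cap C)\ge\min\left((1-\eta)\mu(C),\ \mu(Y)/\eta\right)$, where $R.Y=\bigcup_{\gamma\in R}\gamma.Y$. For $f\in L^2(\Omega,\mu)$ let $\|f\|_{2,X}=(\int_X|f(x)|^2\,d\mu(x))^{1/2}$ and $(\gamma.f)(x)=f(\gamma^{-1}.x)$. The action has local spectral gap with respect to $X$ if there exist a finite set $Q\subseteq\Gamma$ and a constant $c>0$ such that for every $f\in L^2(\Omega,\mu)$ with $\int_Xf\,d\mu=0$ we have $\|f\|_{2,X}\le c\sum_{\gamma\in Q}\|\gamma.f-f\|_{2,X}$. *)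

theory Defs
  imports "HOL-Analysis.Analysis" "HOL-Algebra.Group_Action"
begin

text \<open>
  The Polish space is the whole type \<open>'w\<close>. Since \<open>\<phi>\<close> is a homomorphism into the group of
  permutations of \<open>'w\<close>, Borel measurability of every \<open>\<phi> g\<close> already makes each \<open>\<phi> g\<close> a Borel
  automorphism: its inverse is \<open>\<phi> (inv g)\<close>.
\<close>

locale invariant_borel_action =
  group_action G "UNIV :: 'w::polish_space set" \<phi> + sigma_finite_measure M
  for G :: "('g, 'm) monoid_scheme" (structure)
    and \<phi> :: "'g \<Rightarrow> 'w::polish_space \<Rightarrow> 'w"
    and M :: "'w::polish_space measure" +
  assumes sets_eq_borel: "sets M = sets borel"
    and open_nonzero: "open U \<Longrightarrow> U \<noteq> {} \<Longrightarrow> emeasure M U \<noteq> 0"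
    and borel_action: "g \<in> carrier G \<Longrightarrow> \<phi> g \<in> borel_measurable borel"
    and invariant: "g \<in> carrier G \<Longrightarrow> A \<in> sets borel \<Longrightarrow> emeasure M (\<phi> g ` A) = emeasure M A"

text \<open>
  Measurable sets and functions are those of \<^term>\<open>completion M\<close>. All sets whose real-valued
  \<^const>\<open>measure\<close> is taken below lie inside \<open>C\<close>, so they have finite measure.
\<close>

definition domain_of_expansion ::
  "('g, 'm) monoid_scheme \<Rightarrow> ('g \<Rightarrow> 'w \<Rightarrow> 'w) \<Rightarrow> 'w measure \<Rightarrow> 'w set \<Rightarrow> bool" where
  "domain_of_expansion G \<phi> M C \<longleftrightarrow>
     C \<in> sets (completion M) \<and>
     0 < emeasure (completion M) C \<and> emeasure (completion M) C < \<infinity> \<and>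
     (\<forall>\<eta>::real. \<eta> > 0 \<longrightarrow>
       (\<exists>R. finite R \<and> R \<subseteq> carrier G \<and>
         (\<forall>Y. Y \<in> sets (completion M) \<and> Y \<subseteq> C \<longrightarrow>
           measure (completion M) ((\<Union>\<gamma>\<in>R. \<phi> \<gamma> ` Y) \<inter> C)
             \<ge> min ((1 - \<eta>) * measure (completion M) C) (measure (completion M) Y / \<eta>))))"

definition square_integrable :: "'w measure \<Rightarrow> ('w \<Rightarrow> complex) \<Rightarrow> bool" where
  "square_integrable M f \<longleftrightarrow>
     f \<in> borel_measurable (completion M) \<and> integrable (completion M) (\<lambda>x. (cmod (f x))\<^sup>2)"

definition norm2_on :: "'w measure \<Rightarrow> 'w set \<Rightarrow> ('w \<Rightarrow> complex) \<Rightarrow> real" where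
  "norm2_on M X f = sqrt (LINT x:X|completion M. (cmod (f x))\<^sup>2)"

definition translate ::
  "('g, 'm) monoid_scheme \<Rightarrow> ('g \<Rightarrow> 'w \<Rightarrow> 'w) \<Rightarrow> 'g \<Rightarrow> ('w \<Rightarrow> complex) \<Rightarrow> 'w \<Rightarrow> complex" where
  "translate G \<phi> \<gamma> f = (\<lambda>x. f (\<phi> (inv\<^bsub>G\<^esub> \<gamma>) x))"

definition local_spectral_gap ::
  "('g, 'm) monoid_scheme \<Rightarrow> ('g \<Rightarrow> 'w \<Rightarrow> 'w) \<Rightarrow> 'w measure \<Rightarrow> 'w set \<Rightarrow> bool" where
  "local_spectral_gap G \<phi> M X \<longleftrightarrow>
     (\<exists>Q c. finite Q \<and> Q \<subseteq> carrier G \<and> (c::real) > 0 \<and>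
       (\<forall>f. square_integrable M f \<and> (LINT x:X|completion M. f x) = 0 \<longrightarrow>
         norm2_on M X f \<le> c * (\<Sum>\<gamma>\<in>Q. norm2_on M X (\<lambda>x. translate G \<phi> \<gamma> f x - f x))))"

end

theory Submission
  imports Defs
begin

text \<open>
  Both implications relate the growth of a set under translation, measured inside \<open>X\<close>, to the
  displacement of functions having that set as a level set. Write \<open>m\<close> for the measure of \<open>X\<close>.

  \<^bold>\<open>Expansion gives a gap.\<close> Expansion with \<open>\<eta> = 1/4\<close> yields a finite \<open>R\<close> such that any
  \<open>Y \<subseteq> X\<close> of measure at most \<open>m/2\<close> has \<open>R.Y \<inter> X\<close> of measure at least \<open>3/2\<close> times that of \<open>Y\<close>.
  For a real function \<open>u\<close> let \<open>t\<close> be a median on \<open>X\<close> and let \<open>h\<close> be the positive or the negative part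
  of \<open>u - t\<close>, so that every set \<open>{h > s}\<close> with \<open>s > 0\<close> qualifies as \<open>Y\<close>. If \<open>D\<close> dominates all
  jumps \<open>|\<gamma>.u - u|\<close> with \<open>\<gamma> \<in> R\<close>, then the translates of \<open>{h > s}\<close> meet \<open>X\<close> only inside
  \<open>{h + D > s}\<close>. So the superlevel sets of \<open>h + D\<close> are larger than those of \<open>h\<close> by the
  factor \<open>3/2\<close> at every level, and integrating over levels makes the integral of \<open>(h + D)\<^sup>2\<close> at
  least \<open>3/2\<close> times that of \<open>h\<^sup>2\<close>. As \<open>(h + D)\<^sup>2 \<le> 5/4 h\<^sup>2 + 5 D\<^sup>2\<close>, the integral of \<open>h\<^sup>2\<close> is
  controlled by that of \<open>D\<^sup>2\<close>. A function of mean zero is closer to \<open>0\<close> in \<open>L\<^sup>2\<close> than to any other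
  constant, in particular \<open>t\<close>, so this bounds \<open>u\<close> itself. The argument is
  \<open>dirichlet_bound_of_expansion\<close>, applied to real and imaginary parts.

  \<^bold>\<open>A gap gives expansion.\<close> Let \<open>S\<close> be the symmetric set \<open>Q \<union> Q\<inverse> \<union> {1}\<close>, let \<open>A\<^sub>n = S\<^sup>n.Y\<close> and let
  \<open>p\<^sub>n\<close> be the measure of \<open>A\<^sub>n \<inter> X\<close>. The gap is tested on the indicator of \<open>A\<^sub>n\<close> minus its mean over
  \<open>X\<close>. The test set has to be the full \<open>A\<^sub>n\<close> and not its trace on \<open>X\<close>: because
  \<open>A\<^bsub>n-1\<^esub> \<subseteq> \<gamma>.A\<^sub>n \<subseteq> A\<^bsub>n+1\<^esub>\<close> for \<open>\<gamma> \<in> Q\<close>, the symmetric difference of \<open>\<gamma>.A\<^sub>n\<close> and \<open>A\<^sub>n\<close> lies in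
  \<open>A\<^bsub>n+1\<^esub> - A\<^bsub>n-1\<^esub>\<close>, which says that a large displacement is growth. The gap
  thus becomes the inequality \<open>p\<^sub>n (m - p\<^sub>n)/m \<le> (c|Q|)\<^sup>2 (p\<^bsub>n+1\<^esub> - p\<^bsub>n-1\<^esub>)\<close> of
  \<open>orbit_growth_of_gap\<close>, and as long as \<open>p\<^sub>n < (1 - \<eta>) m\<close> it forces geometric growth.
\<close>

section \<open>Level sets, medians and square integrable functions\<close>

lemma nn_integral_layer_cake:
  fixes u :: "'a \<Rightarrow> real"
  assumes "sigma_finite_measure N" and [measurable]: "u \<in> borel_measurable N"
  shows "(\<integral>\<^sup>+x. ennreal (u x) \<partial>N) = (\<integral>\<^sup>+s. indicator {0<..} s * emeasure N {x \<in> space N. u x > s} \<partial>lborel)"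
proof -
  interpret pair_sigma_finite N "lborel :: real measure"
    using assms(1) by (simp add: pair_sigma_finite_def lborel.sigma_finite_measure_axioms)
  have slice: "ennreal (u x) = (\<integral>\<^sup>+s. indicator {0<..} s * indicator {y \<in> space N. u y > s} x \<partial>lborel)"
    if "x \<in> space N" for x
  proof -
    have "(\<integral>\<^sup>+s. indicator {0<..} s * indicator {y \<in> space N. u y > s} x \<partial>lborel)
        = (\<integral>\<^sup>+s. indicator {0<..<u x} s \<partial>lborel)"
      using that by (intro nn_integral_cong) (auto split: split_indicator)
    also have "\<dots> = emeasure lborel {0<..<u x}"
      by simp
    also have "\<dots> = ennreal (u x)"
      by (cases "0 \<le> u x") (auto simp: ennreal_neg)
    finally show ?thesis by simp
  qed
  have "(\<integral>\<^sup>+x. ennreal (u x) \<partial>N)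
      = (\<integral>\<^sup>+x. \<integral>\<^sup>+s. indicator {0<..} s * indicator {y \<in> space N. u y > s} x \<partial>lborel \<partial>N)"
    by (intro nn_integral_cong slice)
  also have "\<dots> = (\<integral>\<^sup>+s. \<integral>\<^sup>+x. indicator {0<..} s * indicator {y \<in> space N. u y > s} x \<partial>N \<partial>lborel)"
    by (rule Fubini'[symmetric]) measurable
  also have "\<dots> = (\<integral>\<^sup>+s. indicator {0<..} s * emeasure N {x \<in> space N. u x > s} \<partial>lborel)"
    by (intro nn_integral_cong) (simp add: nn_integral_cmult)
  finally show ?thesis .
qed

text \<open>
  By the layer cake formula an inequality between the measures of superlevel sets, valid at every
  positive level, integrates to the inequality between the integrals.
\<close>

lemma (in finite_measure) integral_le_of_superlevel_le:
  fixes u v :: "'a \<Rightarrow> real"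
  assumes u: "integrable M u" "\<And>x. x \<in> space M \<Longrightarrow> 0 \<le> u x"
    and v: "integrable M v" "\<And>x. x \<in> space M \<Longrightarrow> 0 \<le> v x"
    and K: "0 \<le> K"
    and le: "\<And>s. 0 < s \<Longrightarrow> K * measure M {x \<in> space M. u x > s} \<le> measure M {x \<in> space M. v x > s}"
  shows "K * (LINT x|M. u x) \<le> (LINT x|M. v x)"
proof -
  note cake = nn_integral_layer_cake[OF sigma_finite_measure_axioms]
  have [measurable]: "u \<in> borel_measurable M" "v \<in> borel_measurable M"
    using u v by auto
  have [measurable]: "(\<lambda>s. indicator {0<..} s * emeasure M {x \<in> space M. u x > s}) \<in> borel_measurable lborel"
    by measurable
  have "ennreal K * (\<integral>\<^sup>+x. ennreal (u x) \<partial>M)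
      = (\<integral>\<^sup>+s. ennreal K * (indicator {0<..} s * emeasure M {x \<in> space M. u x > s}) \<partial>lborel)"
    by (simp add: cake nn_integral_cmult)
  also have "\<dots> \<le> (\<integral>\<^sup>+s. indicator {0<..} s * emeasure M {x \<in> space M. v x > s} \<partial>lborel)"
    using le K by (intro nn_integral_mono)
      (auto simp: emeasure_eq_measure ennreal_mult[symmetric] split: split_indicator)
  also have "\<dots> = (\<integral>\<^sup>+x. ennreal (v x) \<partial>M)"
    by (simp add: cake)
  finally have "ennreal (K * (LINT x|M. u x)) \<le> ennreal (LINT x|M. v x)"
    using u v K by (simp add: nn_integral_eq_integral ennreal_mult integral_nonneg_AE)
  moreover have "0 \<le> (LINT x|M. v x)"
    using v by (intro integral_nonneg_AE) auto
  ultimately show ?thesis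
    by (simp add: ennreal_le_iff)
qed

text \<open>
  The infimum of the levels that at most half of the mass exceeds is a median: both bounds survive
  the limit because the strict superlevel and sublevel sets are increasing unions.
\<close>

lemma (in finite_measure) median_exists:
  fixes u :: "'a \<Rightarrow> real"
  assumes [measurable]: "u \<in> borel_measurable M"
  obtains t where "measure M {x \<in> space M. u x > t} \<le> measure M (space M) / 2"
    and "measure M {x \<in> space M. u x < t} \<le> measure M (space M) / 2"
proof (cases "measure M (space M) = 0")
  case True
  then have "measure M {x \<in> space M. P x} = 0" for P
    by (metis (no_types, lifting) bounded_measure measure_le_0_iff)
  then show ?thesis
    by (intro that[of 0]) auto
next
  case False
  let ?m = "measure M (space M)"
  have m: "?m > 0"
    using False by (simp add: zero_less_measure_iff)
  let ?F = "\<lambda>s. measure M {x \<in> space M. u x > s}"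
  have F_mono: "?F s' \<le> ?F s" if "s \<le> s'" for s s'
    using that by (intro finite_measure_mono) auto
  \<comment> \<open>The limits of \<open>?F\<close> at infinity make the set of admissible levels nonempty and bounded below.\<close>
  have "(\<lambda>n. ?F (real n)) \<longlonglongrightarrow> measure M (\<Inter>n. {x \<in> space M. u x > real n})"
    by (intro finite_Lim_measure_decseq) (auto simp: decseq_def)
  moreover have "(\<Inter>n. {x \<in> space M. u x > real n}) = {}"
  proof -
    have "\<not> (\<forall>n. u x > real n)" for x
      using reals_Archimedean2[of "u x"] by (auto simp: not_less intro: less_imp_le)
    then show ?thesis by auto
  qed
  ultimately have "(\<lambda>n. ?F (real n)) \<longlonglongrightarrow> 0" by simp
  then have "\<forall>\<^sub>F n in sequentially. ?F (real n) < ?m / 2"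
    using m by (intro order_tendstoD) auto
  then obtain a where a: "?F a < ?m / 2"
    by (auto simp: eventually_sequentially)
  have "(\<lambda>n. ?F (- real n)) \<longlonglongrightarrow> measure M (\<Union>n. {x \<in> space M. u x > - real n})"
    by (intro finite_Lim_measure_incseq) (auto simp: incseq_def)
  moreover have "(\<Union>n. {x \<in> space M. u x > - real n}) = space M"
  proof -
    have "\<exists>n. u x > - real n" for x
      using reals_Archimedean2[of "- u x"] by (auto simp: minus_less_iff)
    then show ?thesis by auto
  qed
  ultimately have "(\<lambda>n. ?F (- real n)) \<longlonglongrightarrow> ?m" by simp
  then have "\<forall>\<^sub>F n in sequentially. ?F (- real n) > ?m / 2"
    using m by (intro order_tendstoD) auto
  then obtain b where b: "?F b > ?m / 2"
    by (auto simp: eventually_sequentially)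
  define S where "S = {s. ?F s \<le> ?m / 2}"
  have "a \<in> S" using a by (simp add: S_def)
  have S_lb: "b \<le> s" if "s \<in> S" for s
  proof (rule ccontr)
    assume "\<not> b \<le> s"
    then have "?F b \<le> ?F s" by (intro F_mono) simp
    moreover have "?F s \<le> ?m / 2" using that unfolding S_def by blast
    ultimately show False using b by linarith
  qed
  then have bdd: "bdd_below S" by (rule bdd_belowI)
  define t where "t = Inf S"
  have right: "?F s \<le> ?m / 2" if "t < s" for s
  proof -
    have "S \<noteq> {}" using \<open>a \<in> S\<close> by (rule ex_in_conv[THEN iffD1, OF exI])
    then obtain s' where "s' \<in> S" "s' < s"
      using cInf_lessD[of S s] \<open>t < s\<close>[unfolded t_def] by metis
    have "?F s \<le> ?F s'" using \<open>s' < s\<close> by (intro F_mono) simp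
    moreover have "?F s' \<le> ?m / 2" using \<open>s' \<in> S\<close> unfolding S_def by blast
    ultimately show ?thesis by linarith
  qed
  have left: "?F s > ?m / 2" if "s < t" for s
  proof -
    have "s \<notin> S" using cInf_lower[OF _ bdd, of s] that unfolding t_def by auto
    then have "\<not> ?F s \<le> ?m / 2" unfolding S_def by blast
    then show ?thesis by linarith
  qed
  define e :: "nat \<Rightarrow> real" where "e n = inverse (real (Suc n))" for n
  have e_pos: "0 < e n" for n
    by (simp add: e_def)
  have e_mono: "e n' \<le> e n" if "n \<le> n'" for n n'
    unfolding e_def using that by (intro le_imp_inverse_le) auto
  have e_small: "\<exists>n. e n < d" if "0 < d" for d
    using reals_Archimedean[OF that] by (auto simp: e_def)
  show ?thesis
  proof (rule that)
    have "(\<lambda>n. ?F (t + e n)) \<longlonglongrightarrow> measure M (\<Union>n. {x \<in> space M. u x > t + e n})"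
    proof (intro finite_Lim_measure_incseq)
      show "incseq (\<lambda>n. {x \<in> space M. u x > t + e n})"
        unfolding incseq_def using e_mono by (auto intro: le_less_trans[OF add_left_mono])
    qed auto
    moreover have "(\<Union>n. {x \<in> space M. u x > t + e n}) = {x \<in> space M. u x > t}"
    proof -
      have "(\<exists>n. u x > t + e n) \<longleftrightarrow> u x > t" for x
      proof
        assume "\<exists>n. u x > t + e n"
        then show "u x > t" using e_pos by (smt (verit))
      next
        assume "u x > t"
        then obtain n where "e n < u x - t" using e_small[of "u x - t"] by auto
        then show "\<exists>n. u x > t + e n" by (intro exI[of _ n]) simp
      qed
      then show ?thesis by auto
    qed
    ultimately have "(\<lambda>n. ?F (t + e n)) \<longlonglongrightarrow> ?F t" by simp
    then show "?F t \<le> ?m / 2"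
      by (rule LIMSEQ_le_const2) (intro exI allI impI right less_add_same_cancel1[THEN iffD2] e_pos)
  next
    let ?L = "\<lambda>s. measure M {x \<in> space M. u x \<le> s}"
    have L: "?L s \<le> ?m / 2" if "s < t" for s
    proof -
      have "{x \<in> space M. u x \<le> s} = space M - {x \<in> space M. u x > s}" by auto
      then have "?L s = ?m - ?F s" by (simp add: finite_measure_compl)
      then show ?thesis using left[OF that] by linarith
    qed
    have "(\<lambda>n. ?L (t - e n)) \<longlonglongrightarrow> measure M (\<Union>n. {x \<in> space M. u x \<le> t - e n})"
    proof (intro finite_Lim_measure_incseq)
      show "incseq (\<lambda>n. {x \<in> space M. u x \<le> t - e n})"
        unfolding incseq_def using e_mono by (auto intro: order_trans[OF _ diff_left_mono])
    qed auto
    moreover have "(\<Union>n. {x \<in> space M. u x \<le> t - e n}) = {x \<in> space M. u x < t}"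
    proof -
      have "(\<exists>n. u x \<le> t - e n) \<longleftrightarrow> u x < t" for x
      proof
        assume "\<exists>n. u x \<le> t - e n"
        then show "u x < t" using e_pos by (smt (verit))
      next
        assume "u x < t"
        then obtain n where "e n < t - u x" using e_small[of "t - u x"] by auto
        then show "\<exists>n. u x \<le> t - e n" by (intro exI[of _ n]) simp
      qed
      then show ?thesis by auto
    qed
    ultimately have "(\<lambda>n. ?L (t - e n)) \<longlonglongrightarrow> measure M {x \<in> space M. u x < t}" by simp
    then show "measure M {x \<in> space M. u x < t} \<le> ?m / 2"
      by (rule LIMSEQ_le_const2) (intro exI allI impI L diff_less e_pos, simp add: e_pos)
  qed
qed

text \<open>
  Expanding the square leaves \<open>t\<^sup>2\<close> times the total mass as the difference of the two sides.
\<close>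

lemma (in finite_measure) integral_square_le_of_mean_zero:
  fixes u :: "'a \<Rightarrow> real"
  assumes "integrable M u" "integrable M (\<lambda>x. (u x)\<^sup>2)" "(LINT x|M. u x) = 0"
  shows "(LINT x|M. (u x)\<^sup>2) \<le> (LINT x|M. (u x - t)\<^sup>2)"
proof -
  have "(LINT x|M. (u x - t)\<^sup>2) = (LINT x|M. (u x)\<^sup>2 - 2 * t * u x + t\<^sup>2)"
    by (simp add: power2_diff algebra_simps)
  also have "\<dots> = (LINT x|M. (u x)\<^sup>2) + t\<^sup>2 * measure M (space M)"
    using assms by simp
  finally show ?thesis by simp
qed

text \<open>
  Growth by a factor above \<open>1\<close> cannot come from \<open>h\<close> alone, so it must be paid for by \<open>D\<close>: the
  layer cake formula gives the factor \<open>3/2\<close> for the squares, and Young's inequality with a constant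
  \<open>5/4 < 3/2\<close> in front of \<open>h\<^sup>2\<close> lets the \<open>h\<close> terms be absorbed.
\<close>

lemma (in finite_measure) integral_square_le_of_superlevel_growth:
  fixes h D :: "'a \<Rightarrow> real"
  assumes h: "h \<in> borel_measurable M" "integrable M (\<lambda>x. (h x)\<^sup>2)" "\<And>x. x \<in> space M \<Longrightarrow> 0 \<le> h x"
    and D: "D \<in> borel_measurable M" "integrable M (\<lambda>x. (D x)\<^sup>2)" "\<And>x. x \<in> space M \<Longrightarrow> 0 \<le> D x"
    and growth: "\<And>s. 0 < s \<Longrightarrow>
      3 / 2 * measure M {x \<in> space M. h x > s} \<le> measure M {x \<in> space M. h x + D x > s}"
  shows "(LINT x|M. (h x)\<^sup>2) \<le> 20 * (LINT x|M. (D x)\<^sup>2)"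
proof -
  \<comment> \<open>This is the expansion of \<open>(h/2 - 2 D)\<^sup>2 \<ge> 0\<close>.\<close>
  have young: "(h x + D x)\<^sup>2 \<le> 5 / 4 * (h x)\<^sup>2 + 5 * (D x)\<^sup>2" for x
    using zero_le_power2[of "h x / 2 - 2 * D x"] by (simp add: power2_eq_square field_simps)
  have int_bound: "integrable M (\<lambda>x. 5 / 4 * (h x)\<^sup>2 + 5 * (D x)\<^sup>2)"
    using h D by simp
  have int: "integrable M (\<lambda>x. (h x + D x)\<^sup>2)"
    by (rule Bochner_Integration.integrable_bound[OF int_bound]) (use h D young in auto)
  have sqrt_less: "s < y\<^sup>2 \<longleftrightarrow> sqrt s < y" if "0 \<le> y" for s y :: real
    using real_sqrt_less_iff[of s "y\<^sup>2"] that by simp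
  have "3 / 2 * (LINT x|M. (h x)\<^sup>2) \<le> (LINT x|M. (h x + D x)\<^sup>2)"
  proof (rule integral_le_of_superlevel_le)
    fix s :: real assume "0 < s"
    have "{x \<in> space M. (h x)\<^sup>2 > s} = {x \<in> space M. h x > sqrt s}"
      "{x \<in> space M. (h x + D x)\<^sup>2 > s} = {x \<in> space M. h x + D x > sqrt s}"
      using h(3) D(3) by (auto simp: sqrt_less)
    then show "3 / 2 * measure M {x \<in> space M. (h x)\<^sup>2 > s} \<le> measure M {x \<in> space M. (h x + D x)\<^sup>2 > s}"
      using growth[of "sqrt s"] \<open>0 < s\<close> by simp
  qed (use h int in auto)
  also have "\<dots> \<le> (LINT x|M. 5 / 4 * (h x)\<^sup>2 + 5 * (D x)\<^sup>2)"
    by (intro integral_mono int int_bound young)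
  also have "\<dots> = 5 / 4 * (LINT x|M. (h x)\<^sup>2) + 5 * (LINT x|M. (D x)\<^sup>2)"
    using h D by simp
  finally show ?thesis by simp
qed

lemma (in finite_measure) integrable_of_integrable_norm_square:
  fixes f :: "'a \<Rightarrow> 'b :: {banach, second_countable_topology}"
  assumes "f \<in> borel_measurable M" "integrable M (\<lambda>x. (norm (f x))\<^sup>2)"
  shows "integrable M f"
proof (rule Bochner_Integration.integrable_bound)
  show "integrable M (\<lambda>x. (norm (f x))\<^sup>2 + 1)"
    using assms by simp
  have "norm (f x) \<le> (norm (f x))\<^sup>2 + 1" for x
    using zero_le_power2[of "norm (f x) - 1 / 2"] by (simp add: power2_diff power_divide)
  then show "AE x in M. norm (f x) \<le> norm ((norm (f x))\<^sup>2 + 1)"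
    by auto
qed (rule assms)

lemma finite_measure_restrict_spaceI:
  assumes "X \<in> sets N" "emeasure N X < \<infinity>"
  shows "finite_measure (restrict_space N X)"
proof (rule finite_measureI)
  have X: "X \<inter> space N = X"
    using sets.sets_into_space[OF assms(1)] by auto
  show "emeasure (restrict_space N X) (space (restrict_space N X)) \<noteq> \<infinity>"
    using assms by (simp add: space_restrict_space X emeasure_restrict_space)
qed

lemma integrable_cmod_diff_square:
  fixes f g :: "'a \<Rightarrow> complex"
  assumes "f \<in> borel_measurable N" "integrable N (\<lambda>x. (cmod (f x))\<^sup>2)"
    and "g \<in> borel_measurable N" "integrable N (\<lambda>x. (cmod (g x))\<^sup>2)"
  shows "integrable N (\<lambda>x. (cmod (f x - g x))\<^sup>2)"
proof (rule Bochner_Integration.integrable_bound)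
  show "integrable N (\<lambda>x. 2 * (cmod (f x))\<^sup>2 + 2 * (cmod (g x))\<^sup>2)"
    using assms by simp
  have "(cmod (f x - g x))\<^sup>2 \<le> 2 * (cmod (f x))\<^sup>2 + 2 * (cmod (g x))\<^sup>2" for x
  proof -
    have "(cmod (f x - g x))\<^sup>2 \<le> (cmod (f x) + cmod (g x))\<^sup>2"
      by (intro power_mono norm_triangle_ineq4) simp
    also have "\<dots> \<le> 2 * (cmod (f x))\<^sup>2 + 2 * (cmod (g x))\<^sup>2"
      using zero_le_power2[of "cmod (f x) - cmod (g x)"] by (simp add: power2_eq_square algebra_simps)
    finally show ?thesis .
  qed
  then show "AE x in N. norm ((cmod (f x - g x))\<^sup>2) \<le> norm (2 * (cmod (f x))\<^sup>2 + 2 * (cmod (g x))\<^sup>2)"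
    by auto
qed (use assms in measurable)

lemma norm2_on_eq_restrict_space:
  assumes "X \<in> sets (completion M)"
  shows "norm2_on M X f = sqrt (LINT x|restrict_space (completion M) X. (cmod (f x))\<^sup>2)"
proof -
  have "X \<inter> space (completion M) \<in> sets (completion M)"
    using assms by (intro sets.Int) auto
  from integral_restrict_space[OF this, of "\<lambda>x. (cmod (f x))\<^sup>2"] show ?thesis
    by (simp add: norm2_on_def set_lebesgue_integral_def)
qed

lemma norm2_on_nonneg: "0 \<le> norm2_on M X f"
  by (simp add: norm2_on_def set_lebesgue_integral_def integral_nonneg_AE)

section \<open>The action on the completed measure space\<close>

context invariant_borel_action
begin

lemma action_inverse:
  assumes "g \<in> carrier G"
  shows "\<phi> (inv g) (\<phi> g x) = x" "\<phi> g (\<phi> (inv g) x) = x"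
proof -
  interpret group G
    using group_hom by (simp add: group_hom_def)
  show "\<phi> (inv g) (\<phi> g x) = x" "\<phi> g (\<phi> (inv g) x) = x"
    using orbit_sym_aux[OF assms] orbit_sym_aux[OF inv_closed[OF assms]] assms by auto
qed

text \<open>
  A Borel automorphism that preserves the measure preserves null sets in both directions, so it
  stays measurable and measure preserving after completion.
\<close>

lemma action_distr:
  assumes "g \<in> carrier G"
  shows "\<phi> g \<in> completion M \<rightarrow>\<^sub>M completion M" "distr (completion M) (completion M) (\<phi> g) = completion M"
proof -
  interpret group G
    using group_hom by (simp add: group_hom_def)
  have [measurable]: "\<phi> g \<in> M \<rightarrow>\<^sub>M M"
    using borel_action[OF assms] by (simp add: measurable_cong_sets[OF sets_eq_borel sets_eq_borel])
  have space: "space M = UNIV"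
    using sets_eq_imp_space_eq[OF sets_eq_borel] by simp
  have "distr M M (\<phi> g) = M"
  proof (rule measure_eqI)
    fix A assume "A \<in> sets (distr M M (\<phi> g))"
    then have A: "A \<in> sets M" by simp
    have "\<phi> g -` A = \<phi> (inv g) ` A"
    proof (intro equalityI subsetI)
      fix x assume "x \<in> \<phi> g -` A"
      then show "x \<in> \<phi> (inv g) ` A"
        by (intro image_eqI[where x = "\<phi> g x"]) (simp_all add: action_inverse[OF assms])
    qed (auto simp: action_inverse[OF assms])
    then show "emeasure (distr M M (\<phi> g)) A = emeasure M A"
      using A assms invariant[of "inv g" A] by (simp add: emeasure_distr space sets_eq_borel)
  qed simp
  then have distr: "distr (completion M) M (\<phi> g) = M"
    by (simp add: distr_completion)
  have meas: "\<phi> g \<in> completion M \<rightarrow>\<^sub>M M"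
    by (simp add: measurable_completion)
  show "distr (completion M) (completion M) (\<phi> g) = completion M"
    using completion.completion_distr_eq[OF meas] by (simp add: distr)
  show "\<phi> g \<in> completion M \<rightarrow>\<^sub>M completion M"
    using completion.measurable_completion2[OF meas] by (simp add: distr)
qed

lemma action_image:
  assumes "g \<in> carrier G" "A \<in> sets (completion M)"
  shows "\<phi> g ` A \<in> sets (completion M)" "emeasure (completion M) (\<phi> g ` A) = emeasure (completion M) A"
proof -
  interpret group G
    using group_hom by (simp add: group_hom_def)
  have i: "inv g \<in> carrier G" using assms by simp
  have space: "space M = UNIV"
    using sets_eq_imp_space_eq[OF sets_eq_borel] by simp
  have eq: "\<phi> g ` A = \<phi> (inv g) -` A \<inter> space (completion M)"
  proof (intro equalityI subsetI)
    fix x assume "x \<in> \<phi> (inv g) -` A \<inter> space (completion M)"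
    then show "x \<in> \<phi> g ` A"
      by (intro image_eqI[where x = "\<phi> (inv g) x"]) (simp_all add: action_inverse[OF assms(1)])
  qed (auto simp: action_inverse[OF assms(1)] space)
  show "\<phi> g ` A \<in> sets (completion M)"
    unfolding eq using measurable_sets[OF action_distr(1)[OF i] assms(2)] .
  show "emeasure (completion M) (\<phi> g ` A) = emeasure (completion M) A"
    unfolding eq using emeasure_distr[OF action_distr(1)[OF i] assms(2)] action_distr(2)[OF i] by simp
qed

lemma square_integrable_translate_diff:
  assumes "g \<in> carrier G" and f: "square_integrable M f"
  shows "square_integrable M (\<lambda>x. translate G \<phi> g f x - f x)"
proof -
  interpret group G
    using group_hom by (simp add: group_hom_def)
  note act = action_distr[OF inv_closed[OF assms(1)]]
  have [measurable]: "f \<in> borel_measurable (completion M)" "\<phi> (inv g) \<in> completion M \<rightarrow>\<^sub>M completion M"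
    using f act by (auto simp: square_integrable_def)
  have "integrable (completion M) (\<lambda>x. (cmod (f (\<phi> (inv g) x)))\<^sup>2)"
    using integrable_distr_eq[OF act(1), of "\<lambda>x. (cmod (f x))\<^sup>2"] f act(2)
    by (simp add: square_integrable_def)
  then show ?thesis
    using f unfolding square_integrable_def translate_def
    by (intro conjI integrable_cmod_diff_square) auto
qed

section \<open>From expansion to a spectral gap\<close>

text \<open>
  If \<open>h\<close> exceeds \<open>s\<close> at a point \<open>y\<close> of \<open>X\<close>, then \<open>h + D\<close> exceeds \<open>s\<close> at every translate of \<open>y\<close> that
  falls into \<open>X\<close>. A level set filling at most half of \<open>X\<close> is small enough for both terms of the
  minimum to be at least \<open>3/2\<close> times its measure.
\<close>

lemma superlevel_growth_of_expansion:
  assumes X: "X \<in> sets (completion M)" "emeasure (completion M) X < \<infinity>"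
    and R: "finite R" "R \<subseteq> carrier G"
    and expands: "\<And>Y. Y \<in> sets (completion M) \<Longrightarrow> Y \<subseteq> X \<Longrightarrow>
      min (3 / 4 * measure (completion M) X) (4 * measure (completion M) Y)
        \<le> measure (completion M) ((\<Union>\<gamma>\<in>R. \<phi> \<gamma> ` Y) \<inter> X)"
    and meas: "h \<in> borel_measurable (completion M)" "D \<in> borel_measurable (completion M)"
    and jump: "\<And>\<gamma> x. \<gamma> \<in> R \<Longrightarrow> x \<in> X \<Longrightarrow> h (\<phi> (inv \<gamma>) x) - h x \<le> D x"
    and half: "measure (completion M) {x \<in> X. h x > s} \<le> measure (completion M) X / 2"
  shows "3 / 2 * measure (completion M) {x \<in> X. h x > (s::real)}
      \<le> measure (completion M) {x \<in> X. h x + D x > s}"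
proof -
  note [measurable] = meas X(1)
  have sets: "{x \<in> X. P x} \<in> sets (completion M)" if "{x \<in> space (completion M). P x} \<in> sets (completion M)" for P
  proof -
    have "{x \<in> X. P x} = X \<inter> {x \<in> space (completion M). P x}"
      using sets.sets_into_space[OF X(1)] by auto
    then show ?thesis using X(1) that by simp
  qed
  let ?Y = "{x \<in> X. h x > s}" and ?Z = "{x \<in> X. h x + D x > s}"
  have Y: "?Y \<in> sets (completion M)" and Z: "?Z \<in> sets (completion M)"
    by (rule sets, measurable)+
  have "(\<Union>\<gamma>\<in>R. \<phi> \<gamma> ` ?Y) \<inter> X \<subseteq> ?Z"
  proof
    fix x assume "x \<in> (\<Union>\<gamma>\<in>R. \<phi> \<gamma> ` ?Y) \<inter> X"
    then obtain \<gamma> y where *: "\<gamma> \<in> R" "h y > s" "x = \<phi> \<gamma> y" "x \<in> X" by auto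
    moreover have "\<phi> (inv \<gamma>) x = y"
      using * R action_inverse[of \<gamma> y] by auto
    ultimately show "x \<in> ?Z"
      using jump[of \<gamma> x] by auto
  qed
  moreover have "?Z \<in> fmeasurable (completion M)"
    using X Z emeasure_mono[of ?Z X "completion M"] by (intro fmeasurableI) (auto intro: le_less_trans)
  moreover have "(\<Union>\<gamma>\<in>R. \<phi> \<gamma> ` ?Y) \<inter> X \<in> sets (completion M)"
    using R Y X by (intro sets.Int sets.finite_UN action_image) auto
  ultimately have "measure (completion M) ((\<Union>\<gamma>\<in>R. \<phi> \<gamma> ` ?Y) \<inter> X) \<le> measure (completion M) ?Z"
    by (intro measure_mono_fmeasurable) auto
  then show ?thesis
    using expands[OF Y Collect_restrict] half measure_nonneg[of "completion M" ?Y] by linarith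
qed

text \<open>
  A median is subtracted so that the positive and the negative part of \<open>u - t\<close> each have support of
  at most half the mass of \<open>X\<close>. Taking parts does not increase jumps, so each part is bounded by
  \<open>20\<close> times the integral of \<open>D\<^sup>2\<close>.
\<close>

lemma dirichlet_bound_of_expansion:
  fixes u :: "'w \<Rightarrow> real" and N :: "'w measure" and X :: "'w set"
  defines "N \<equiv> restrict_space (completion M) X"
  assumes X: "X \<in> sets (completion M)" "emeasure (completion M) X < \<infinity>"
    and R: "finite R" "R \<subseteq> carrier G"
    and expands: "\<And>Y. Y \<in> sets (completion M) \<Longrightarrow> Y \<subseteq> X \<Longrightarrow>
      min (3 / 4 * measure (completion M) X) (4 * measure (completion M) Y)
        \<le> measure (completion M) ((\<Union>\<gamma>\<in>R. \<phi> \<gamma> ` Y) \<inter> X)"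
    and u: "u \<in> borel_measurable (completion M)" "integrable N (\<lambda>x. (u x)\<^sup>2)" "(LINT x|N. u x) = 0"
    and D: "D \<in> borel_measurable (completion M)" "integrable N (\<lambda>x. (D x)\<^sup>2)" "\<And>x. 0 \<le> D x"
    and jump: "\<And>\<gamma> x. \<gamma> \<in> R \<Longrightarrow> x \<in> X \<Longrightarrow> \<bar>u (\<phi> (inv \<gamma>) x) - u x\<bar> \<le> D x"
  shows "(LINT x|N. (u x)\<^sup>2) \<le> 40 * (LINT x|N. (D x)\<^sup>2)"
proof -
  have X_space: "X \<inter> space (completion M) \<in> sets (completion M)"
    using X by (intro sets.Int) auto
  have space_N: "space N = X"
    using sets.sets_into_space[OF X(1)] by (auto simp: N_def space_restrict_space)
  have measure_N: "measure N A = measure (completion M) A" if "A \<subseteq> X" for A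
    unfolding N_def by (rule measure_restrict_space[OF X_space that])
  interpret N: finite_measure N
    unfolding N_def by (rule finite_measure_restrict_spaceI[OF X])
  have meas_N: "w \<in> borel_measurable N" if "w \<in> borel_measurable (completion M)" for w :: "'w \<Rightarrow> real"
    unfolding N_def using that by (rule measurable_restrict_space1)
  have int_shift: "integrable N (\<lambda>x. (u x - t)\<^sup>2)" for t
  proof (rule Bochner_Integration.integrable_bound)
    show "integrable N (\<lambda>x. 2 * (u x)\<^sup>2 + 2 * t\<^sup>2)"
      using u by simp
    have "(u x - t)\<^sup>2 \<le> 2 * (u x)\<^sup>2 + 2 * t\<^sup>2" for x
      using zero_le_power2[of "u x + t"] by (simp add: power2_eq_square algebra_simps)
    then show "AE x in N. norm ((u x - t)\<^sup>2) \<le> norm (2 * (u x)\<^sup>2 + 2 * t\<^sup>2)"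
      by auto
  qed (use meas_N[OF u(1)] in measurable)
  have int_u: "integrable N u"
    using N.integrable_of_integrable_norm_square[OF meas_N[OF u(1)]] u(2) by simp
  obtain t where t: "measure N {x \<in> space N. u x > t} \<le> measure N (space N) / 2"
      "measure N {x \<in> space N. u x < t} \<le> measure N (space N) / 2"
    using N.median_exists[OF meas_N[OF u(1)]] by metis
  have part_le: "(max 0 (\<sigma> * (u x - t)))\<^sup>2 \<le> (u x - t)\<^sup>2" if "\<bar>\<sigma>\<bar> = 1" for \<sigma> x
  proof -
    have "(max 0 (\<sigma> * (u x - t)))\<^sup>2 \<le> (\<bar>\<sigma>\<bar> * \<bar>u x - t\<bar>)\<^sup>2"
      by (intro power_mono) (auto simp: abs_mult[symmetric])
    then show ?thesis
      using that by simp
  qed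
  \<comment> \<open>The sign \<open>\<sigma>\<close> selects the positive or the negative part of \<open>u - t\<close>.\<close>
  have part: "(LINT x|N. (max 0 (\<sigma> * (u x - t)))\<^sup>2) \<le> 20 * (LINT x|N. (D x)\<^sup>2)"
    if \<sigma>: "\<bar>\<sigma>\<bar> = 1" and half: "measure N {x \<in> space N. \<sigma> * (u x - t) > 0} \<le> measure N (space N) / 2" for \<sigma>
  proof -
    let ?h = "\<lambda>x. max 0 (\<sigma> * (u x - t))"
    have h_meas: "?h \<in> borel_measurable (completion M)"
      using u(1) by measurable
    have h_le: "(?h x)\<^sup>2 \<le> (u x - t)\<^sup>2" for x
      using part_le[OF \<sigma>] .
    show ?thesis
    proof (rule N.integral_square_le_of_superlevel_growth)
      show "integrable N (\<lambda>x. (?h x)\<^sup>2)"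
        by (rule Bochner_Integration.integrable_bound[OF int_shift[of t]])
          (use h_le meas_N[OF h_meas] in auto)
      fix s :: real assume s: "0 < s"
      have "measure N {x \<in> space N. ?h x > s} \<le> measure N {x \<in> space N. \<sigma> * (u x - t) > 0}"
        using s meas_N[OF u(1)] by (intro N.finite_measure_mono) (auto simp: max_def split: if_splits)
      then have half': "measure (completion M) {x \<in> X. ?h x > s} \<le> measure (completion M) X / 2"
        using half by (simp add: space_N measure_N)
      have "?h (\<phi> (inv \<gamma>) x) - ?h x \<le> D x" if "\<gamma> \<in> R" "x \<in> X" for \<gamma> x
      proof -
        have "?h (\<phi> (inv \<gamma>) x) - ?h x \<le> \<bar>\<sigma> * (u (\<phi> (inv \<gamma>) x) - t) - \<sigma> * (u x - t)\<bar>"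
          by (simp add: max_def abs_if)
        also have "\<dots> = \<bar>\<sigma>\<bar> * \<bar>u (\<phi> (inv \<gamma>) x) - u x\<bar>"
          by (simp add: abs_mult[symmetric] algebra_simps)
        also have "\<dots> \<le> D x"
          using jump[OF that] \<sigma> by simp
        finally show ?thesis .
      qed
      from superlevel_growth_of_expansion[OF X R expands h_meas D(1) this half']
      show "3 / 2 * measure N {x \<in> space N. ?h x > s} \<le> measure N {x \<in> space N. ?h x + D x > s}"
        by (simp add: space_N measure_N)
    qed (use meas_N[OF h_meas] meas_N[OF D(1)] D in auto)
  qed
  have split: "(u x - t)\<^sup>2 = (max 0 (1 * (u x - t)))\<^sup>2 + (max 0 (- 1 * (u x - t)))\<^sup>2" for x
    by (simp add: max_def power2_commute)
  have int_part: "integrable N (\<lambda>x. (max 0 (\<sigma> * (u x - t)))\<^sup>2)" if "\<bar>\<sigma>\<bar> = 1" for \<sigma>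
    by (rule Bochner_Integration.integrable_bound[OF int_shift[of t]])
      (use part_le[OF that] meas_N[OF u(1)] in auto)
  have "(LINT x|N. (u x)\<^sup>2) \<le> (LINT x|N. (u x - t)\<^sup>2)"
    by (rule N.integral_square_le_of_mean_zero[OF int_u u(2,3)])
  also have "\<dots> = (LINT x|N. (max 0 (1 * (u x - t)))\<^sup>2) + (LINT x|N. (max 0 (- 1 * (u x - t)))\<^sup>2)"
    unfolding split by (intro Bochner_Integration.integral_add int_part) auto
  also have "\<dots> \<le> 20 * (LINT x|N. (D x)\<^sup>2) + 20 * (LINT x|N. (D x)\<^sup>2)"
    using t by (intro add_mono part) (auto simp: algebra_simps)
  finally show ?thesis by simp
qed

lemma local_spectral_gap_of_expansion:
  assumes "domain_of_expansion G \<phi> M X"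
  shows "local_spectral_gap G \<phi> M X"
proof -
  define N where "N = restrict_space (completion M) X"
  have X: "X \<in> sets (completion M)" "emeasure (completion M) X < \<infinity>"
    and "\<forall>\<eta>::real. \<eta> > 0 \<longrightarrow>
       (\<exists>R. finite R \<and> R \<subseteq> carrier G \<and>
         (\<forall>Y. Y \<in> sets (completion M) \<and> Y \<subseteq> X \<longrightarrow>
           measure (completion M) ((\<Union>\<gamma>\<in>R. \<phi> \<gamma> ` Y) \<inter> X)
             \<ge> min ((1 - \<eta>) * measure (completion M) X) (measure (completion M) Y / \<eta>)))"
    using assms unfolding domain_of_expansion_def by blast+
  from this(3)[rule_format, of "1 / 4"] obtain R where R: "finite R" "R \<subseteq> carrier G"
    and expands: "\<And>Y. Y \<in> sets (completion M) \<Longrightarrow> Y \<subseteq> X \<Longrightarrow>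
      min (3 / 4 * measure (completion M) X) (4 * measure (completion M) Y)
        \<le> measure (completion M) ((\<Union>\<gamma>\<in>R. \<phi> \<gamma> ` Y) \<inter> X)"
    by (auto simp: mult.commute)
  have X_space: "X \<inter> space (completion M) \<in> sets (completion M)"
    using X by (intro sets.Int) auto
  interpret N: finite_measure N
    unfolding N_def by (rule finite_measure_restrict_spaceI[OF X])
  \<comment> \<open>Two times \<open>40\<close> for real and imaginary part, \<open>card R\<close> from the square of a sum; the summand
    \<open>1\<close> keeps the constant positive when \<open>R\<close> is empty.\<close>
  define c where "c = sqrt (80 * card R) + 1"
  have "norm2_on M X f \<le> c * (\<Sum>\<gamma>\<in>R. norm2_on M X (\<lambda>x. translate G \<phi> \<gamma> f x - f x))"
    if f: "square_integrable M f" and mean: "(LINT x:X|completion M. f x) = 0" for f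
  proof -
    let ?d = "\<lambda>\<gamma> x. cmod (translate G \<phi> \<gamma> f x - f x)"
    define D where "D x = (\<Sum>\<gamma>\<in>R. ?d \<gamma> x)" for x
    let ?n = "\<lambda>\<gamma>. norm2_on M X (\<lambda>x. translate G \<phi> \<gamma> f x - f x)"
    have int_N: "integrable N w" if "integrable (completion M) w" for w :: "'w \<Rightarrow> real"
      unfolding N_def integrable_restrict_space[OF X_space]
      by (rule integrable_mult_indicator[OF X(1) that])
    have f_meas [measurable]: "f \<in> borel_measurable (completion M)"
      using f by (simp add: square_integrable_def)
    have d_meas [measurable]: "?d \<gamma> \<in> borel_measurable (completion M)" if "\<gamma> \<in> R" for \<gamma>
    proof -
      have "(\<lambda>x. translate G \<phi> \<gamma> f x - f x) \<in> borel_measurable (completion M)"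
        using square_integrable_translate_diff[OF _ f, of \<gamma>] R that
        unfolding square_integrable_def by auto
      then show ?thesis by measurable
    qed
    have d_int: "integrable N (\<lambda>x. (?d \<gamma> x)\<^sup>2)" if "\<gamma> \<in> R" for \<gamma>
      using square_integrable_translate_diff[OF _ f, of \<gamma>] R that
      unfolding square_integrable_def by (intro int_N) auto
    have D_meas: "D \<in> borel_measurable (completion M)"
      unfolding D_def by (intro borel_measurable_sum d_meas)
    have D_sq: "(D x)\<^sup>2 \<le> card R * (\<Sum>\<gamma>\<in>R. (?d \<gamma> x)\<^sup>2)" for x
      unfolding D_def using sum_squared_le_sum_of_squares[of "\<lambda>\<gamma>. ?d \<gamma> x" R] by (simp add: mult.commute)
    have sq_int: "integrable N (\<lambda>x. card R * (\<Sum>\<gamma>\<in>R. (?d \<gamma> x)\<^sup>2))"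
      using d_int by simp
    have D_int: "integrable N (\<lambda>x. (D x)\<^sup>2)"
    proof (rule Bochner_Integration.integrable_bound[OF sq_int])
      show "(\<lambda>x. (D x)\<^sup>2) \<in> borel_measurable N"
        unfolding N_def using D_meas by (intro measurable_restrict_space1) measurable
      show "AE x in N. norm ((D x)\<^sup>2) \<le> norm (card R * (\<Sum>\<gamma>\<in>R. (?d \<gamma> x)\<^sup>2))"
        using D_sq by (intro always_eventually allI) (auto intro: order_trans[OF _ abs_ge_self])
    qed
    have norm_sq: "(norm2_on M X g)\<^sup>2 = (LINT x|N. (cmod (g x))\<^sup>2)" for g
      by (simp add: norm2_on_eq_restrict_space[OF X(1)] N_def integral_nonneg_AE)
    have "(LINT x|N. (D x)\<^sup>2) \<le> (LINT x|N. card R * (\<Sum>\<gamma>\<in>R. (?d \<gamma> x)\<^sup>2))"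
      by (intro integral_mono D_int sq_int D_sq)
    also have "\<dots> = card R * (\<Sum>\<gamma>\<in>R. (?n \<gamma>)\<^sup>2)"
      using d_int by (simp add: norm_sq)
    also have "\<dots> \<le> card R * (\<Sum>\<gamma>\<in>R. ?n \<gamma>)\<^sup>2"
      using L2_set_le_sum[of R ?n] by (intro mult_left_mono sqrt_le_D) (auto simp: norm2_on_nonneg L2_set_def)
    finally have D_le: "(LINT x|N. (D x)\<^sup>2) \<le> card R * (\<Sum>\<gamma>\<in>R. ?n \<gamma>)\<^sup>2" .
    have f_sq: "integrable N (\<lambda>x. (cmod (f x))\<^sup>2)"
      using f unfolding square_integrable_def by (intro int_N) auto
    have f_int: "integrable N f"
    proof (rule N.integrable_of_integrable_norm_square[OF _ f_sq])
      show "f \<in> borel_measurable N"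
        unfolding N_def by (rule measurable_restrict_space1[OF f_meas])
    qed
    have mean_N: "(LINT x|N. f x) = 0"
      using mean integral_restrict_space[OF X_space, of f]
      by (simp add: N_def set_lebesgue_integral_def)
    have part: "(LINT x|N. (p (f x))\<^sup>2) \<le> 40 * (LINT x|N. (D x)\<^sup>2)" "integrable N (\<lambda>x. (p (f x))\<^sup>2)"
      if p: "p = Re \<or> p = Im" for p
    proof -
      have p_meas [measurable]: "p \<in> borel_measurable borel"
        using p by auto
      have p_diff: "p a - p b = p (a - b)" and p_le: "\<bar>p a\<bar> \<le> cmod a" for a b
        using p abs_Re_le_cmod abs_Im_le_cmod by auto
      show p_int: "integrable N (\<lambda>x. (p (f x))\<^sup>2)"
      proof (rule Bochner_Integration.integrable_bound[OF f_sq])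
        show "(\<lambda>x. (p (f x))\<^sup>2) \<in> borel_measurable N"
          unfolding N_def by (intro measurable_restrict_space1) measurable
        show "AE x in N. norm ((p (f x))\<^sup>2) \<le> norm ((cmod (f x))\<^sup>2)"
          using p_le by (auto simp: abs_le_square_iff[symmetric])
      qed
      have "(LINT x|N. p (f x)) = p (LINT x|N. f x)"
        using p f_int by auto
      then have p_mean: "(LINT x|N. p (f x)) = 0"
        using mean_N p by auto
      show "(LINT x|N. (p (f x))\<^sup>2) \<le> 40 * (LINT x|N. (D x)\<^sup>2)"
      proof (rule dirichlet_bound_of_expansion[OF X R expands, folded N_def, where u = "\<lambda>x. p (f x)"])
        show "\<bar>p (f (\<phi> (inv \<gamma>) x)) - p (f x)\<bar> \<le> D x" if "\<gamma> \<in> R" for \<gamma> x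
        proof -
          have "\<bar>p (f (\<phi> (inv \<gamma>) x)) - p (f x)\<bar> \<le> ?d \<gamma> x"
            unfolding p_diff translate_def by (rule p_le)
          also have "\<dots> \<le> D x"
            unfolding D_def using R that by (intro member_le_sum) auto
          finally show ?thesis .
        qed
      qed (use p_int p_mean D_meas D_int in \<open>auto simp: D_def sum_nonneg\<close>)
    qed
    have "(norm2_on M X f)\<^sup>2 = (LINT x|N. (Re (f x))\<^sup>2) + (LINT x|N. (Im (f x))\<^sup>2)"
      unfolding norm_sq cmod_power2 using part(2) by (intro Bochner_Integration.integral_add) auto
    also have "\<dots> \<le> 80 * (card R * (\<Sum>\<gamma>\<in>R. ?n \<gamma>)\<^sup>2)"
      using part(1)[of Re] part(1)[of Im] D_le by simp
    also have "\<dots> \<le> (c * (\<Sum>\<gamma>\<in>R. ?n \<gamma>))\<^sup>2"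
    proof -
      have "80 * real (card R) \<le> c\<^sup>2"
        unfolding c_def by (simp add: power2_sum)
      then show ?thesis
        unfolding power_mult_distrib mult.assoc[symmetric] by (intro mult_right_mono) auto
    qed
    finally show ?thesis
      by (rule power2_le_imp_le) (auto simp: c_def intro!: mult_nonneg_nonneg add_nonneg_nonneg sum_nonneg norm2_on_nonneg)
  qed
  then show ?thesis
    unfolding local_spectral_gap_def using R
    by (intro exI[of _ R] exI[of _ c]) (auto simp: c_def intro: add_nonneg_pos)
qed

end

section \<open>From a spectral gap to expansion\<close>

primrec set_power :: "('g, 'm) monoid_scheme \<Rightarrow> 'g set \<Rightarrow> nat \<Rightarrow> 'g set" where
  "set_power G S 0 = {\<one>\<^bsub>G\<^esub>}"
| "set_power G S (Suc n) = S <#>\<^bsub>G\<^esub> set_power G S n"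

lemma finite_set_power: "finite S \<Longrightarrow> finite (set_power G S n)"
  by (induction n) (auto simp: set_mult_def)

lemma (in group) set_power_subset_carrier: "S \<subseteq> carrier G \<Longrightarrow> set_power G S n \<subseteq> carrier G"
  by (induction n) (auto simp: set_mult_def)

text \<open>
  The gap controls increments over two steps in terms of the middle value, which monotonicity bounds
  below by the first; hence the factor \<open>1 + \<delta>\<close> is gained per two steps.
\<close>

lemma geometric_growth_two_step:
  fixes p :: "nat \<Rightarrow> real"
  assumes mono: "\<And>n. p n \<le> p (Suc n)" and "0 \<le> \<delta>"
    and growth: "\<And>n. p (Suc n) < L \<Longrightarrow> p (Suc (Suc n)) - p n \<ge> \<delta> * p (Suc n)"
  shows "p (2 * j) \<ge> min L ((1 + \<delta>) ^ j * p 0)"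
proof (induction j)
  case (Suc j)
  show ?case
  proof (cases "p (Suc (2 * j)) < L")
    case True
    have "(1 + \<delta>) ^ j * p 0 \<le> p (2 * j)"
      using Suc.IH True mono[of "2 * j"] by auto
    then have "(1 + \<delta>) * ((1 + \<delta>) ^ j * p 0) \<le> (1 + \<delta>) * p (2 * j)"
      using \<open>0 \<le> \<delta>\<close> by (intro mult_left_mono) auto
    also have "\<dots> \<le> p (2 * j) + \<delta> * p (Suc (2 * j))"
      using mult_left_mono[OF mono[of "2 * j"] \<open>0 \<le> \<delta>\<close>] by (simp add: algebra_simps)
    also have "\<dots> \<le> p (2 * Suc j)"
      using growth[OF True] by simp
    finally show ?thesis by (simp add: mult.assoc)
  next
    case False
    then show ?thesis using mono[of "Suc (2 * j)"] by simp
  qed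
qed simp

context invariant_borel_action
begin

text \<open>
  The gap is applied to the indicator of \<open>A\<close> minus its mean \<open>t = a/m\<close> over \<open>X\<close>, whose square integral
  over \<open>X\<close> is \<open>a (m - a)/m\<close>. For \<open>x \<in> X\<close>, the indicators of \<open>\<gamma>.A\<close> and \<open>A\<close> agree on \<open>B\<close>, where both
  are \<open>1\<close>, and outside \<open>A'\<close>, where both are \<open>0\<close>; so each displacement has norm at most
  the square root of the measure of \<open>(A' - B) \<inter> X\<close>.
\<close>

lemma orbit_growth_of_gap:
  assumes X: "X \<in> sets (completion M)" "0 < emeasure (completion M) X" "emeasure (completion M) X < \<infinity>"
    and Q: "finite Q" "Q \<subseteq> carrier G" and c: "0 < c"
    and gap: "\<And>f. square_integrable M f \<Longrightarrow> (LINT x:X|completion M. f x) = 0 \<Longrightarrow>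
      norm2_on M X f \<le> c * (\<Sum>\<gamma>\<in>Q. norm2_on M X (\<lambda>x. translate G \<phi> \<gamma> f x - f x))"
    and A: "A \<in> sets (completion M)" "emeasure (completion M) A < \<infinity>" "B \<in> sets (completion M)" "B \<subseteq> A"
    and A': "A' \<in> sets (completion M)" "A \<subseteq> A'"
    and up: "\<And>\<gamma>. \<gamma> \<in> Q \<Longrightarrow> \<phi> \<gamma> ` A \<subseteq> A'" and down: "\<And>\<gamma>. \<gamma> \<in> Q \<Longrightarrow> \<phi> (inv \<gamma>) ` B \<subseteq> A"
  defines "m \<equiv> measure (completion M) X" and "a \<equiv> measure (completion M) (A \<inter> X)"
  shows "a * (m - a) / m
    \<le> (c * card Q)\<^sup>2 * (measure (completion M) (A' \<inter> X) - measure (completion M) (B \<inter> X))"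
proof -
  interpret group G
    using group_hom by (simp add: group_hom_def)
  define N where "N = restrict_space (completion M) X"
  interpret N: finite_measure N
    unfolding N_def by (rule finite_measure_restrict_spaceI[OF X(1,3)])
  have X_space: "X \<inter> space (completion M) \<in> sets (completion M)"
    using X by (intro sets.Int) auto
  have space_N: "space N = X"
    using sets.sets_into_space[OF X(1)] by (auto simp: N_def space_restrict_space)
  have measure_N: "measure N E = measure (completion M) E" if "E \<subseteq> X" for E
    unfolding N_def by (rule measure_restrict_space[OF X_space that])
  have sets_N: "E \<inter> X \<in> sets N" if "E \<in> sets (completion M)" for E
    unfolding N_def using that X(1) by (auto simp: sets_restrict_space)
  have m: "m > 0"
    using X unfolding m_def measure_def by (simp add: enn2real_positive_iff less_top)
  define t where "t = a / m"
  \<comment> \<open>Constants need not be square integrable on the whole space. The constant \<open>t\<close> is therefore cut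
    off to \<open>W\<close>, which contains all points where the gap inequality evaluates the function.\<close>
  define W where "W = X \<union> (\<Union>\<gamma>\<in>Q. \<phi> (inv \<gamma>) ` X)"
  have W: "W \<in> sets (completion M)" "emeasure (completion M) W < \<infinity>"
  proof -
    have sets: "\<phi> (inv \<gamma>) ` X \<in> sets (completion M)" if "\<gamma> \<in> Q" for \<gamma>
      using that Q X by (intro action_image) auto
    then show "W \<in> sets (completion M)"
      unfolding W_def using Q X by auto
    have "emeasure (completion M) (\<Union>\<gamma>\<in>Q. \<phi> (inv \<gamma>) ` X) \<le> (\<Sum>\<gamma>\<in>Q. emeasure (completion M) (\<phi> (inv \<gamma>) ` X))"
      using sets Q by (intro emeasure_subadditive_finite) auto
    also have "\<dots> = (\<Sum>\<gamma>\<in>Q. emeasure (completion M) X)"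
      using Q X by (intro sum.cong action_image) auto
    also have "\<dots> < \<infinity>"
      using X Q by (simp add: ennreal_mult_less_top of_nat_less_top)
    finally have "emeasure (completion M) X + emeasure (completion M) (\<Union>\<gamma>\<in>Q. \<phi> (inv \<gamma>) ` X) < \<infinity>"
      using X by simp
    then show "emeasure (completion M) W < \<infinity>"
      unfolding W_def using sets Q X
      by (intro le_less_trans[OF emeasure_subadditive]) auto
  qed
  define f :: "'w \<Rightarrow> complex" where "f x = of_real (indicator A x - t * indicator W x)" for x
  have f_sq: "square_integrable M f"
    unfolding square_integrable_def
  proof
    show f_meas: "f \<in> borel_measurable (completion M)"
      unfolding f_def using A W by measurable
    show "integrable (completion M) (\<lambda>x. (cmod (f x))\<^sup>2)"
    proof (rule Bochner_Integration.integrable_bound)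
      show "integrable (completion M) (\<lambda>x. 2 * indicator A x + 2 * t\<^sup>2 * indicator W x :: real)"
        by (intro Bochner_Integration.integrable_add integrable_mult_right integrable_real_indicator A W)
      have "(cmod (f x))\<^sup>2 \<le> 2 * indicator A x + 2 * t\<^sup>2 * indicator W x" for x
        using zero_le_power2[of "1 + t"] unfolding f_def norm_of_real power2_abs
        by (auto simp: indicator_def power2_eq_square algebra_simps)
      then show "AE x in completion M. norm ((cmod (f x))\<^sup>2) \<le> norm (2 * indicator A x + 2 * t\<^sup>2 * indicator W x :: real)"
        by (intro always_eventually allI) (auto intro: order_trans)
    qed (use f_meas in measurable)
  qed
  have int_A: "integrable N (indicator A :: _ \<Rightarrow> real)" and LINT_A: "(LINT x|N. indicator A x) = a"
  proof -
    have eq: "(indicator A x :: real) = indicator (A \<inter> X) x" if "x \<in> space N" for x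
      using that by (simp add: space_N indicator_def)
    have "integrable N (indicator (A \<inter> X) :: _ \<Rightarrow> real)"
      using sets_N[OF A(1)] by (simp add: integrable_indicator_iff less_top[symmetric])
    then show "integrable N (indicator A :: _ \<Rightarrow> real)"
      using eq by (simp cong: Bochner_Integration.integrable_cong)
    have "(LINT x|N. indicator A x :: real) = (LINT x|N. indicator (A \<inter> X) x)"
      using eq by (intro Bochner_Integration.integral_cong) auto
    also have "\<dots> = a"
      unfolding a_def by (simp add: space_N measure_N Int_absorb2)
    finally show "(LINT x|N. indicator A x) = a" .
  qed
  have measure_space_N: "measure N (space N) = m"
    unfolding m_def by (simp add: space_N measure_N)
  have f_X: "f x = of_real (indicator A x - t)" if "x \<in> X" for x
    using that by (simp add: f_def W_def)
  have mean: "(LINT x:X|completion M. f x) = 0"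
  proof -
    have "(LINT x:X|completion M. f x) = (LINT x|N. f x)"
      using integral_restrict_space[OF X_space, of f] by (simp add: N_def set_lebesgue_integral_def)
    also have "\<dots> = (LINT x|N. complex_of_real (indicator A x - t))"
      by (intro Bochner_Integration.integral_cong f_X) (auto simp: space_N)
    also have "\<dots> = of_real (LINT x|N. indicator A x - t)"
      by (rule integral_complex_of_real)
    also have "(LINT x|N. indicator A x - t) = a - m * t"
      using int_A LINT_A measure_space_N by simp
    finally show ?thesis using m by (simp add: t_def)
  qed
  have norm_f: "(norm2_on M X f)\<^sup>2 = a * (m - a) / m"
  proof -
    have "(norm2_on M X f)\<^sup>2 = (LINT x|N. (cmod (f x))\<^sup>2)"
      by (simp add: norm2_on_eq_restrict_space[OF X(1)] N_def integral_nonneg_AE)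
    also have "\<dots> = (LINT x|N. (1 - 2 * t) * indicator A x + t\<^sup>2)"
      by (intro Bochner_Integration.integral_cong)
        (auto simp: space_N f_X indicator_def power2_eq_square algebra_simps simp flip: of_real_diff)
    also have "\<dots> = (1 - 2 * t) * a + m * t\<^sup>2"
      using int_A LINT_A measure_space_N by simp
    also have "\<dots> = a * (m - a) / m"
      using m by (simp add: t_def field_simps power2_eq_square)
    finally show ?thesis .
  qed
  define d where "d = measure (completion M) (A' \<inter> X) - measure (completion M) (B \<inter> X)"
  have d: "d = (LINT x|N. indicator (A' \<inter> X - B \<inter> X) x)" "0 \<le> d"
  proof -
    have sub: "B \<inter> X \<subseteq> A' \<inter> X" using A A' by auto
    have "measure N (A' \<inter> X - B \<inter> X) = measure N (A' \<inter> X) - measure N (B \<inter> X)"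
      by (rule N.finite_measure_Diff[OF sets_N sets_N sub]) (use A A' in auto)
    then have "d = measure N (A' \<inter> X - B \<inter> X)"
      by (simp add: d_def measure_N)
    moreover have "(A' \<inter> X - B \<inter> X) \<inter> space N = A' \<inter> X - B \<inter> X"
      by (auto simp: space_N)
    ultimately show "d = (LINT x|N. indicator (A' \<inter> X - B \<inter> X) x)" "0 \<le> d"
      by simp_all
  qed
  have jump: "norm2_on M X (\<lambda>x. translate G \<phi> \<gamma> f x - f x) \<le> sqrt d" if \<gamma>: "\<gamma> \<in> Q" for \<gamma>
  proof -
    have "(LINT x|N. (cmod (translate G \<phi> \<gamma> f x - f x))\<^sup>2) \<le> (LINT x|N. indicator (A' \<inter> X - B \<inter> X) x)"
    proof (rule Bochner_Integration.integral_mono')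
      show "integrable N (indicator (A' \<inter> X - B \<inter> X) :: _ \<Rightarrow> real)"
        by (intro integrable_real_indicator sets.Diff sets_N A A') (simp add: less_top[symmetric])
      fix x assume "x \<in> space N"
      then have x: "x \<in> X" by (simp add: space_N)
      have \<gamma>': "\<gamma> \<in> carrier G" using \<gamma> Q by auto
      have "\<phi> (inv \<gamma>) x \<in> W" "x \<in> W"
        using x \<gamma> by (auto simp: W_def)
      then have eq: "translate G \<phi> \<gamma> f x - f x = of_real (indicator A (\<phi> (inv \<gamma>) x) - indicator A x)"
        by (simp add: translate_def f_def)
      have "x \<in> A'" if "\<phi> (inv \<gamma>) x \<in> A"
        using up[OF \<gamma>] that imageI[OF that, of "\<phi> \<gamma>"] action_inverse(2)[OF \<gamma>', of x] by auto
      moreover have "\<phi> (inv \<gamma>) x \<in> A" if "x \<in> B"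
        using down[OF \<gamma>] that by auto
      ultimately show "(cmod (translate G \<phi> \<gamma> f x - f x))\<^sup>2 \<le> indicator (A' \<inter> X - B \<inter> X) x"
        unfolding eq norm_of_real power2_abs using x A A' by (auto simp: indicator_def)
    qed simp
    then have "sqrt (LINT x|N. (cmod (translate G \<phi> \<gamma> f x - f x))\<^sup>2) \<le> sqrt d"
      unfolding d(1)[symmetric] by (rule real_sqrt_le_mono)
    then show ?thesis
      unfolding norm2_on_eq_restrict_space[OF X(1)] N_def .
  qed
  have "norm2_on M X f \<le> c * (\<Sum>\<gamma>\<in>Q. norm2_on M X (\<lambda>x. translate G \<phi> \<gamma> f x - f x))"
    by (rule gap[OF f_sq mean])
  also have "\<dots> \<le> c * (\<Sum>\<gamma>\<in>Q. sqrt d)"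
    using c by (intro mult_left_mono sum_mono jump) auto
  also have "\<dots> = c * card Q * sqrt d"
    by simp
  finally have "(norm2_on M X f)\<^sup>2 \<le> (c * card Q * sqrt d)\<^sup>2"
    by (intro power_mono norm2_on_nonneg)
  also have "\<dots> = (c * card Q)\<^sup>2 * d"
    using d(2) by (simp add: power_mult_distrib)
  finally show ?thesis
    unfolding norm_f d_def .
qed

lemma expansion_of_local_spectral_gap:
  assumes X: "X \<in> sets (completion M)" "0 < emeasure (completion M) X" "emeasure (completion M) X < \<infinity>"
    and "local_spectral_gap G \<phi> M X"
  shows "domain_of_expansion G \<phi> M X"
proof -
  interpret group G
    using group_hom by (simp add: group_hom_def)
  obtain Q and c :: real where Q: "finite Q" "Q \<subseteq> carrier G" and c: "0 < c"
    and gap: "\<And>f. square_integrable M f \<Longrightarrow> (LINT x:X|completion M. f x) = 0 \<Longrightarrow>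
      norm2_on M X f \<le> c * (\<Sum>\<gamma>\<in>Q. norm2_on M X (\<lambda>x. translate G \<phi> \<gamma> f x - f x))"
    using assms(4) unfolding local_spectral_gap_def by blast
  define m where "m = measure (completion M) X"
  have m: "m > 0"
    using X unfolding m_def measure_def by (simp add: enn2real_positive_iff less_top)
  define S where "S = insert \<one> (Q \<union> (\<lambda>\<gamma>. inv \<gamma>) ` Q)"
  have S: "finite S" "S \<subseteq> carrier G"
    using Q by (auto simp: S_def)
  note R = finite_set_power[OF S(1), of G] set_power_subset_carrier[OF S(2)]
  have expands: "\<exists>R. finite R \<and> R \<subseteq> carrier G \<and>
         (\<forall>Y. Y \<in> sets (completion M) \<and> Y \<subseteq> X \<longrightarrow>
           measure (completion M) ((\<Union>\<gamma>\<in>R. \<phi> \<gamma> ` Y) \<inter> X)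
             \<ge> min ((1 - \<eta>) * m) (measure (completion M) Y / \<eta>))"
    if \<eta>: "\<eta> > 0" for \<eta> :: real
  proof -
    \<comment> \<open>Adding \<open>1\<close> avoids a division by zero when \<open>Q\<close> is empty.\<close>
    define \<delta> where "\<delta> = \<eta> / (c * card Q + 1)\<^sup>2"
    have pos: "c * card Q + 1 > 0"
      using c by (simp add: add_nonneg_pos)
    have \<delta>: "\<delta> > 0"
      unfolding \<delta>_def using \<eta> pos by simp
    obtain j where j: "1 / \<eta> < (1 + \<delta>) ^ j"
      using real_arch_pow[of "1 + \<delta>" "1 / \<eta>"] \<delta> by auto
    let ?R = "set_power G S (2 * j)"
    have "measure (completion M) ((\<Union>\<gamma>\<in>?R. \<phi> \<gamma> ` Y) \<inter> X) \<ge> min ((1 - \<eta>) * m) (measure (completion M) Y / \<eta>)"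
      if Y: "Y \<in> sets (completion M)" "Y \<subseteq> X" for Y
    proof -
      define A where "A n = (\<Union>\<gamma>\<in>set_power G S n. \<phi> \<gamma> ` Y)" for n
      have translates: "\<phi> \<gamma> ` Y \<in> sets (completion M)" if "\<gamma> \<in> set_power G S n" for \<gamma> n
        using that R(2)[of n] Y by (intro action_image) auto
      have A_sets: "A n \<in> sets (completion M)" for n
        unfolding A_def using R(1) translates by (intro sets.finite_UN) auto
      have Y_fin: "emeasure (completion M) Y < \<infinity>"
        using emeasure_mono[OF Y(2) X(1)] X(3) by (rule le_less_trans)
      have A_fin: "emeasure (completion M) (A n) < \<infinity>" for n
      proof -
        have "emeasure (completion M) (A n) \<le> (\<Sum>\<gamma>\<in>set_power G S n. emeasure (completion M) (\<phi> \<gamma> ` Y))"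
          unfolding A_def using R(1) translates by (intro emeasure_subadditive_finite) auto
        also have "\<dots> = (\<Sum>\<gamma>\<in>set_power G S n. emeasure (completion M) Y)"
          using R[of n] Y by (intro sum.cong action_image) auto
        also have "\<dots> < \<infinity>"
          using Y_fin by (simp add: ennreal_mult_less_top of_nat_less_top)
        finally show ?thesis .
      qed
      have step: "\<phi> s ` A n \<subseteq> A (Suc n)" if "s \<in> S" for s n
      proof
        fix x assume "x \<in> \<phi> s ` A n"
        then obtain \<gamma> y where *: "\<gamma> \<in> set_power G S n" "y \<in> Y" "x = \<phi> s (\<phi> \<gamma> y)"
          by (auto simp: A_def)
        then have "x = \<phi> (s \<otimes> \<gamma>) y"
          using that R[of n] S by (subst composition_rule) auto
        then show "x \<in> A (Suc n)"
          using * that by (auto simp: A_def set_mult_def)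
      qed
      have one: "\<phi> \<one> x = x" for x
        using id_eq_one by (metis restrict_apply' UNIV_I)
      have A_mono: "A n \<subseteq> A (Suc n)" for n
        using step[of \<one> n] by (auto simp: S_def one)
      define p where "p n = measure (completion M) (A n \<inter> X)" for n
      have p_mono: "p n \<le> p (Suc n)" for n
        unfolding p_def
      proof (rule measure_mono_fmeasurable)
        show "A n \<inter> X \<subseteq> A (Suc n) \<inter> X"
          using A_mono[of n] by blast
        show "A n \<inter> X \<in> sets (completion M)"
          by (intro sets.Int A_sets X)
        show "A (Suc n) \<inter> X \<in> fmeasurable (completion M)"
          by (intro fmeasurable_Int_fmeasurable fmeasurableI A_sets A_fin X(1))
      qed
      have p_0: "p 0 = measure (completion M) Y"
        using Y by (simp add: p_def A_def one Int_absorb2)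
      have "min ((1 - \<eta>) * m) ((1 + \<delta>) ^ j * p 0) \<le> p (2 * j)"
      proof (rule geometric_growth_two_step)
        fix n assume less: "p (Suc n) < (1 - \<eta>) * m"
        have p_nonneg: "0 \<le> p k" for k
          by (simp add: p_def)
        have "\<eta> * p (Suc n) = p (Suc n) * (\<eta> * m) / m"
          using m by simp
        also have "\<dots> \<le> p (Suc n) * (m - p (Suc n)) / m"
          using less m p_nonneg by (intro divide_right_mono mult_left_mono) (auto simp: algebra_simps)
        \<comment> \<open>The middle set \<open>A (Suc n)\<close> is the test set; \<open>A n\<close> and \<open>A (Suc (Suc n))\<close> enclose its translates.\<close>
        also have "\<dots> \<le> (c * card Q)\<^sup>2 * (p (Suc (Suc n)) - p n)"
          unfolding p_def m_def
        proof (rule orbit_growth_of_gap[OF X Q c gap])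
          show "\<phi> \<gamma> ` A (Suc n) \<subseteq> A (Suc (Suc n))" if "\<gamma> \<in> Q" for \<gamma>
            using that by (intro step) (auto simp: S_def)
          show "\<phi> (inv \<gamma>) ` A n \<subseteq> A (Suc n)" if "\<gamma> \<in> Q" for \<gamma>
            using that by (intro step) (auto simp: S_def)
        qed (use A_sets A_fin A_mono in auto)
        also have "\<dots> \<le> (c * card Q + 1)\<^sup>2 * (p (Suc (Suc n)) - p n)"
          using c p_mono[of n] p_mono[of "Suc n"] by (intro mult_right_mono power_mono) auto
        finally show "\<delta> * p (Suc n) \<le> p (Suc (Suc n)) - p n"
          unfolding \<delta>_def using pos by (simp add: field_simps)
      qed (use p_mono \<delta> in auto)
      moreover have "measure (completion M) Y / \<eta> \<le> (1 + \<delta>) ^ j * p 0"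
        unfolding p_0 using mult_right_mono[OF less_imp_le[OF j], of "measure (completion M) Y"] by simp
      ultimately have "min ((1 - \<eta>) * m) (measure (completion M) Y / \<eta>) \<le> p (2 * j)"
        by linarith
      then show ?thesis
        unfolding p_def A_def .
    qed
    then show ?thesis
      using R by (intro exI[of _ ?R]) blast
  qed
  then show ?thesis
    unfolding domain_of_expansion_def m_def using X by blast
qed

end

theorem lemma5p2:
  fixes G :: "('g, 'm) monoid_scheme"
    and \<phi> :: "'g \<Rightarrow> 'w::polish_space \<Rightarrow> 'w"
    and M :: "'w measure"
    and X :: "'w set"
  assumes "invariant_borel_action G \<phi> M"
    and "X \<in> sets (completion M)"
    and "0 < emeasure (completion M) X"
    and "emeasure (completion M) X < \<infinity>"
  shows "domain_of_expansion G \<phi> M X \<longleftrightarrow> local_spectral_gap G \<phi> M X"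
proof -
  interpret invariant_borel_action G \<phi> M
    by fact
  show ?thesis
    using local_spectral_gap_of_expansion expansion_of_local_spectral_gap[OF assms(2-4)] by blast
qed

end
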